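(* There exists a decentralized shortest path interdiction (DSPI) game with discrete interdiction (in which the agents do not all have the same source-target pair) that has no pure strategy Nash equilibrium.
   Context: A DSPI game with discrete interdiction consists of: a finite directed network $G=(V,A)$; a finite set of agents $\mathcal F=\{1,\dots,F\}$; for each agent $f$ a source $s^f\in V$, a target $t^f\in V$, such that the set $P^f$ of directed $s^f$-$t^f$ paths is nonempty, a budget $b^f>0$ and arc interdiction costs $c^f_{uv}>0$; initial arc lengths $d^0_{uv}\ge 0$ and arc extensions $e_{uv}\ge 0$ for $(u,v)\in A$. Agent $f$ chooses $x^f\in\{0,1\}^{A}$ with $\sum_{(u,v)\in A}c^f_{uv}x^f_{uv}\le b^f$ and wants to maximize $$\theta^f(x^f,x^{-f})=\min_{p\in P^f}\sum_{(u,v)\in p}\Big(d^0_{uv}+e_{uv}\max_{g\in\mathcal F}x^g_{uv}\Big).$$ A pure strategy Nash equilibrium is a profile $(x^1,\dots,x^F)$ such that for every $f$, $x^f$ is feasible and maximizes $\theta^f(\cdot,x^{-f})$ over agent $f$'s feasible set. *)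

theory Defs
  imports
    Complex_Main
    "HOL-Library.FuncSet"
    "Graph_Theory.Pair_Digraph"
begin

type_synonym 'v arc = "'v \<times> 'v"

record 'v dspi =
  network :: "'v pair_pre_digraph"
  num_agents :: nat
  source :: "nat \<Rightarrow> 'v"
  target :: "nat \<Rightarrow> 'v"
  budget :: "nat \<Rightarrow> real"
  cost :: "nat \<Rightarrow> 'v arc \<Rightarrow> real"
  init_length :: "'v arc \<Rightarrow> real"
  extension :: "'v arc \<Rightarrow> real"

definition agents :: "'v dspi \<Rightarrow> nat set" where
  "agents \<Gamma> = {1..num_agents \<Gamma>}"

(* Paths are simple (no repeated vertex), represented by their list of arcs. *)
definition st_paths :: "'v dspi \<Rightarrow> nat \<Rightarrow> 'v arc list set" where
  "st_paths \<Gamma> f =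
     {p. pre_digraph.apath (with_proj (network \<Gamma>)) (source \<Gamma> f) p (target \<Gamma> f)}"

definition dspi_game :: "'v dspi \<Rightarrow> bool" where
  "dspi_game \<Gamma> \<longleftrightarrow>
     pair_fin_digraph (network \<Gamma>) \<and>
     num_agents \<Gamma> \<ge> 1 \<and>
     (\<forall>f\<in>agents \<Gamma>.
        source \<Gamma> f \<in> pverts (network \<Gamma>) \<and>
        target \<Gamma> f \<in> pverts (network \<Gamma>) \<and>
        st_paths \<Gamma> f \<noteq> {} \<and>
        budget \<Gamma> f > 0 \<and>
        (\<forall>a\<in>parcs (network \<Gamma>). cost \<Gamma> f a > 0)) \<and>
     (\<forall>a\<in>parcs (network \<Gamma>). init_length \<Gamma> a \<ge> 0 \<and> extension \<Gamma> a \<ge> 0)"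

definition feasible :: "'v dspi \<Rightarrow> nat \<Rightarrow> ('v arc \<Rightarrow> real) set" where
  "feasible \<Gamma> f =
     {y \<in> parcs (network \<Gamma>) \<rightarrow>\<^sub>E {0, 1}.
        (\<Sum>a\<in>parcs (network \<Gamma>). cost \<Gamma> f a * y a) \<le> budget \<Gamma> f}"

definition arc_length :: "'v dspi \<Rightarrow> (nat \<Rightarrow> 'v arc \<Rightarrow> real) \<Rightarrow> 'v arc \<Rightarrow> real" where
  "arc_length \<Gamma> x a = init_length \<Gamma> a + extension \<Gamma> a * (MAX g\<in>agents \<Gamma>. x g a)"

definition payoff :: "'v dspi \<Rightarrow> nat \<Rightarrow> (nat \<Rightarrow> 'v arc \<Rightarrow> real) \<Rightarrow> real" where
  "payoff \<Gamma> f x = (MIN p\<in>st_paths \<Gamma> f. (\<Sum>a\<in>set p. arc_length \<Gamma> x a))"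

definition pure_nash_equilibrium :: "'v dspi \<Rightarrow> (nat \<Rightarrow> 'v arc \<Rightarrow> real) \<Rightarrow> bool" where
  "pure_nash_equilibrium \<Gamma> x \<longleftrightarrow>
     (\<forall>f\<in>agents \<Gamma>.
        x f \<in> feasible \<Gamma> f \<and>
        (\<forall>y\<in>feasible \<Gamma> f. payoff \<Gamma> f (x(f := y)) \<le> payoff \<Gamma> f x))"

definition common_source_target :: "'v dspi \<Rightarrow> bool" where
  "common_source_target \<Gamma> \<longleftrightarrow>
     (\<forall>f\<in>agents \<Gamma>. \<forall>g\<in>agents \<Gamma>.
        source \<Gamma> f = source \<Gamma> g \<and> target \<Gamma> f = target \<Gamma> g)"

end

theory Submission
  imports Defs
begin

text \<open>
  A variant of matching pennies. Agent 1 travels from 0 to 9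
  and agent 2 from 9 to 0. Write \<open>a = (1,2)\<close>, \<open>b = (3,4)\<close>, \<open>c = (5,6)\<close>, \<open>d = (7,8)\<close> for the four arcs
  with a positive extension. Agent 1 can afford one of \<open>a\<close>, \<open>b\<close>, agent 2 one of \<open>c\<close>, \<open>d\<close>. Every
  path of agent 1 uses \<open>a\<close> and \<open>d\<close> or else \<open>b\<close> and \<open>c\<close>, so agent 1 wants to match \<open>a\<close> with \<open>c\<close> and
  \<open>b\<close> with \<open>d\<close>; every path of agent 2 uses \<open>c\<close> and \<open>a\<close> or else \<open>d\<close> and \<open>b\<close>, so agent 2 wants to match
  \<open>a\<close> with \<open>d\<close> and \<open>b\<close> with \<open>c\<close>. The initial length 1 of the arc \<open>(0,3)\<close> makes \<open>a\<close> strictly profitable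
  for agent 1 when nobody else interdicts, which excludes the profile without any interdiction.
\<close>

lemma pcas_crossing_arc:
  assumes "pcas u p v" "u \<notin> W" "v \<in> W"
  shows "\<exists>e\<in>set p. fst e \<notin> W \<and> snd e \<in> W"
  using assms by (induction p arbitrary: u) auto

lemma finite_st_paths:
  assumes "pair_fin_digraph (network \<Gamma>)"
  shows "finite (st_paths \<Gamma> f)"
proof -
  interpret pair_fin_digraph "network \<Gamma>" by fact
  show ?thesis
    unfolding st_paths_def by (rule apaths_finite)
qed

text \<open>The walk predicates become the recursive functions of pair digraphs, which simp can
  evaluate on an explicit list of arcs.\<close>

lemma st_paths_iff:
  "p \<in> st_paths \<Gamma> f \<longleftrightarrow>
     source \<Gamma> f \<in> pverts (network \<Gamma>) \<and> set p \<subseteq> parcs (network \<Gamma>) \<and>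
     pcas (source \<Gamma> f) p (target \<Gamma> f) \<and>
     distinct (pawalk_verts (source \<Gamma> f) p)"
  by (simp add: st_paths_def pre_digraph.apath_def pre_digraph.awalk_def
      cas_with_proj_eq awalk_verts_with_proj_eq)

lemma payoff_le:
  assumes "pair_fin_digraph (network \<Gamma>)" "p \<in> st_paths \<Gamma> f"
  shows "payoff \<Gamma> f x \<le> (\<Sum>a\<in>set p. arc_length \<Gamma> x a)"
  unfolding payoff_def using finite_st_paths[OF assms(1)] assms(2) by (intro Min_le) auto

text \<open>Every path must enter \<open>W\<close>, and since lengths are nonnegative the entering
  arc alone bounds the whole path from below. Lower bounds thus need one cut instead of an
  enumeration of all paths.\<close>

lemma payoff_ge_cut:
  assumes "pair_fin_digraph (network \<Gamma>)" "st_paths \<Gamma> f \<noteq> {}"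
    and nonneg: "\<And>a. a \<in> parcs (network \<Gamma>) \<Longrightarrow> arc_length \<Gamma> x a \<ge> 0"
    and W: "source \<Gamma> f \<notin> W" "target \<Gamma> f \<in> W"
    and cut: "\<And>u v. (u, v) \<in> parcs (network \<Gamma>) \<Longrightarrow> u \<notin> W \<Longrightarrow> v \<in> W \<Longrightarrow> L \<le> arc_length \<Gamma> x (u, v)"
  shows "L \<le> payoff \<Gamma> f x"
proof -
  have "L \<le> (\<Sum>a\<in>set p. arc_length \<Gamma> x a)" if p: "p \<in> st_paths \<Gamma> f" for p
  proof -
    from p have sub: "set p \<subseteq> parcs (network \<Gamma>)"
      and walk: "pcas (source \<Gamma> f) p (target \<Gamma> f)" by (simp_all add: st_paths_iff)
    obtain e where e: "e \<in> set p" "fst e \<notin> W" "snd e \<in> W"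
      using pcas_crossing_arc[OF walk W] by blast
    then have "L \<le> arc_length \<Gamma> x e"
      using cut[of "fst e" "snd e"] sub by auto
    also have "\<dots> \<le> (\<Sum>a\<in>set p. arc_length \<Gamma> x a)"
      using e sub nonneg by (intro member_le_sum) auto
    finally show ?thesis .
  qed
  then show ?thesis
    unfolding payoff_def using finite_st_paths[OF assms(1)] assms(2) by simp
qed

text \<open>The arcs \<open>(2,7)\<close>, \<open>(4,5)\<close> lead from a to d and from b to c,
  for agent 1; \<open>(6,1)\<close>, \<open>(8,3)\<close> lead from c to a and from d to b, for
  agent 2. The last eight arcs attach the terminals 0 and 9.\<close>

definition cyc_graph :: "nat pair_pre_digraph" where
  "cyc_graph = \<lparr>pverts = {0..9},
     parcs = {(1,2), (3,4), (5,6), (7,8), (2,7), (4,5), (6,1), (8,3),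
       (0,1), (0,3), (6,9), (8,9), (9,5), (9,7), (2,0), (4,0)}\<rparr>"

text \<open>Cost 2 exceeds the budget 1, so it confines each agent to its own two arcs, of which it
  can afford only one.\<close>

definition cyc_game :: "nat dspi" where
  "cyc_game = \<lparr>network = cyc_graph, num_agents = 2,
     source = (\<lambda>f. if f = 1 then 0 else 9),
     target = (\<lambda>f. if f = 1 then 9 else 0),
     budget = (\<lambda>_. 1),
     cost = (\<lambda>f e. if e \<in> (if f = 1 then {(1,2), (3,4)} else {(5,6), (7,8)}) then 1 else 2),
     init_length = (\<lambda>e. if e = (0,3) then 1 else 0),
     extension = (\<lambda>e. if e \<in> {(1,2), (3,4), (5,6), (7,8)} then 2 else 0)\<rparr>"

lemma cyc_game_sel:
  "network cyc_game = cyc_graph"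
  "num_agents cyc_game = 2"
  "source cyc_game f = (if f = 1 then 0 else 9)"
  "target cyc_game f = (if f = 1 then 9 else 0)"
  "budget cyc_game f = 1"
  "cost cyc_game f e = (if e \<in> (if f = 1 then {(1,2), (3,4)} else {(5,6), (7,8)}) then 1 else 2)"
  "init_length cyc_game e = (if e = (0,3) then 1 else 0)"
  "extension cyc_game e = (if e \<in> {(1,2), (3,4), (5,6), (7,8)} then 2 else 0)"
  by (simp_all add: cyc_game_def)

lemma cyc_graph_fin: "pair_fin_digraph (network cyc_game)"
  by unfold_locales (auto simp: cyc_game_sel cyc_graph_def)

lemma agents_cyc: "agents cyc_game = {1, 2}"
  by (auto simp: agents_def cyc_game_sel)

lemma st_paths_cyc:
  "[(0,1), (1,2), (2,7), (7,8), (8,9)] \<in> st_paths cyc_game 1"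
  "[(0,3), (3,4), (4,5), (5,6), (6,9)] \<in> st_paths cyc_game 1"
  "[(9,5), (5,6), (6,1), (1,2), (2,0)] \<in> st_paths cyc_game 2"
  "[(9,7), (7,8), (8,3), (3,4), (4,0)] \<in> st_paths cyc_game 2"
  by (simp_all add: st_paths_iff cyc_game_sel cyc_graph_def)

lemma dspi_game_cyc: "dspi_game cyc_game"
  unfolding dspi_game_def agents_cyc
proof (intro conjI ballI)
  show "pair_fin_digraph (network cyc_game)" by (rule cyc_graph_fin)
  show "st_paths cyc_game f \<noteq> {}" if "f \<in> {1, 2}" for f
    using that st_paths_cyc by auto
qed (auto simp: cyc_game_sel cyc_graph_def)

lemma arc_length_cyc:
  "arc_length cyc_game x e = init_length cyc_game e + extension cyc_game e * max (x 1 e) (x 2 e)"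
  by (simp add: arc_length_def agents_cyc)

text \<open>These are the deviations tested below. The restricted lambda makes them extensional, as
  \<open>feasible\<close> demands.\<close>

definition single :: "nat arc \<Rightarrow> nat arc \<Rightarrow> real" where
  "single e = (\<lambda>e'\<in>parcs cyc_graph. if e' = e then 1 else 0)"

lemma single_feasible:
  assumes "e \<in> (if f = 1 then {(1,2), (3,4)} else {(5,6), (7,8)})"
  shows "single e \<in> feasible cyc_game f"
proof -
  have fin: "finite (parcs cyc_graph)" and e: "e \<in> parcs cyc_graph"
    using assms by (auto simp: cyc_graph_def split: if_splits)
  have "(\<Sum>e'\<in>parcs cyc_graph. cost cyc_game f e' * single e e') =
      (\<Sum>e'\<in>parcs cyc_graph. if e' = e then cost cyc_game f e else 0)"
    by (intro sum.cong) (auto simp: single_def)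
  also have "\<dots> = 1"
    using assms fin e by (simp add: cyc_game_sel)
  finally show ?thesis
    by (auto simp: feasible_def single_def cyc_game_sel)
qed

text \<open>All summands are nonnegative, so the budget also bounds the cost over any subset of
  arcs; subsets of one or two arcs then settle what is affordable.\<close>

lemma feasible_cycD:
  assumes "y \<in> feasible cyc_game f"
  shows "\<And>e. e \<in> parcs cyc_graph \<Longrightarrow> y e = 0 \<or> y e = 1"
    and "\<And>B. B \<subseteq> parcs cyc_graph \<Longrightarrow> (\<Sum>e\<in>B. cost cyc_game f e * y e) \<le> 1"
proof -
  show *: "y e = 0 \<or> y e = 1" if "e \<in> parcs cyc_graph" for e
    using assms that by (auto simp: feasible_def cyc_game_sel)
  show "(\<Sum>e\<in>B. cost cyc_game f e * y e) \<le> 1" if B: "B \<subseteq> parcs cyc_graph" for B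
  proof -
    have "(\<Sum>e\<in>B. cost cyc_game f e * y e) \<le> (\<Sum>e\<in>parcs cyc_graph. cost cyc_game f e * y e)"
    proof (rule sum_mono2[OF _ B])
      show "finite (parcs cyc_graph)" by (simp add: cyc_graph_def)
      show "0 \<le> cost cyc_game f e * y e" if "e \<in> parcs cyc_graph - B" for e
        using *[of e] that by (auto simp: cyc_game_sel)
    qed
    also have "\<dots> \<le> 1"
      using assms by (auto simp: feasible_def cyc_game_sel)
    finally show ?thesis .
  qed
qed

text \<open>Each bound is the length of one path from \<open>st_paths_cyc\<close>; the summand 1
  comes from \<open>(0,3)\<close>.\<close>

lemma payoff_cyc_le:
  "payoff cyc_game 1 x \<le> 2 * max (x 1 (1,2)) (x 2 (1,2)) + 2 * max (x 1 (7,8)) (x 2 (7,8))"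
  "payoff cyc_game 1 x \<le> 1 + 2 * max (x 1 (3,4)) (x 2 (3,4)) + 2 * max (x 1 (5,6)) (x 2 (5,6))"
  "payoff cyc_game 2 x \<le> 2 * max (x 1 (1,2)) (x 2 (1,2)) + 2 * max (x 1 (5,6)) (x 2 (5,6))"
  "payoff cyc_game 2 x \<le> 2 * max (x 1 (3,4)) (x 2 (3,4)) + 2 * max (x 1 (7,8)) (x 2 (7,8))"
  using st_paths_cyc[THEN payoff_le[OF cyc_graph_fin, of _ _ x]]
  by (simp_all add: arc_length_cyc cyc_game_sel)

text \<open>Feasibility for agent 1 already makes each maximum, and hence each length,
  nonnegative.\<close>

lemma payoff_cyc_ge_cut:
  assumes "f \<in> {1, 2}" "x 1 \<in> feasible cyc_game 1"
    and "source cyc_game f \<notin> W" "target cyc_game f \<in> W"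
    and "\<forall>(u, v)\<in>parcs cyc_graph. u \<notin> W \<longrightarrow> v \<in> W \<longrightarrow> L \<le> arc_length cyc_game x (u, v)"
  shows "L \<le> payoff cyc_game f x"
proof (rule payoff_ge_cut[OF cyc_graph_fin _ _ assms(3,4)])
  show "st_paths cyc_game f \<noteq> {}"
    using assms(1) st_paths_cyc by auto
  show "arc_length cyc_game x e \<ge> 0" if "e \<in> parcs (network cyc_game)" for e
  proof -
    have "x 1 e \<ge> 0"
      using feasible_cycD(1)[OF assms(2), of e] that by (auto simp: cyc_game_sel)
    then show ?thesis
      by (auto simp: arc_length_cyc cyc_game_sel max_def)
  qed
qed (use assms(5) in \<open>auto simp: cyc_game_sel\<close>)

lemma payoff_cyc_ge:
  assumes "x 1 \<in> feasible cyc_game 1"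
  shows "x 1 (3,4) = 1 \<Longrightarrow> x 2 (7,8) = 1 \<Longrightarrow> 2 \<le> payoff cyc_game 1 x"
    and "x 1 (1,2) = 1 \<Longrightarrow> 1 \<le> payoff cyc_game 1 x"
    and "x 1 (1,2) = 1 \<Longrightarrow> x 2 (7,8) = 1 \<Longrightarrow> 2 \<le> payoff cyc_game 2 x"
    and "x 1 (3,4) = 1 \<Longrightarrow> x 2 (5,6) = 1 \<Longrightarrow> 2 \<le> payoff cyc_game 2 x"
proof -
  note * = payoff_cyc_ge_cut[of _ x, OF _ assms]
  note defs = arc_length_cyc cyc_game_sel cyc_graph_def
  \<comment> \<open>Only \<open>(3,4)\<close> and \<open>(7,8)\<close> enter this \<open>W\<close>.
    The cuts for agent 2 below likewise consist of exactly the two interdicted arcs.\<close>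
  show "2 \<le> payoff cyc_game 1 x" if "x 1 (3,4) = 1" "x 2 (7,8) = 1"
    by (rule *[where W = "{4,5,6,8,9}"]) (use that in \<open>simp_all add: defs\<close>)
  \<comment> \<open>The entering arcs are \<open>(1,2)\<close>, of length at least 2, and
    \<open>(0,3)\<close>, of length 1.\<close>
  show "1 \<le> payoff cyc_game 1 x" if "x 1 (1,2) = 1"
    by (rule *[where W = "{2,3,4,5,6,7,8,9}"]) (use that in \<open>simp_all add: defs\<close>)
  show "2 \<le> payoff cyc_game 2 x" if "x 1 (1,2) = 1" "x 2 (7,8) = 1"
    by (rule *[where W = "{0,2,3,4,8}"]) (use that in \<open>simp_all add: defs\<close>)
  show "2 \<le> payoff cyc_game 2 x" if "x 1 (3,4) = 1" "x 2 (5,6) = 1"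
    by (rule *[where W = "{0,1,2,4,6}"]) (use that in \<open>simp_all add: defs\<close>)
qed

lemma no_equilibrium_cyc: "\<not> pure_nash_equilibrium cyc_game x"
proof
  assume eq: "pure_nash_equilibrium cyc_game x"
  then have feas: "x 1 \<in> feasible cyc_game 1" "x 2 \<in> feasible cyc_game 2"
    and best1: "\<And>y. y \<in> feasible cyc_game 1 \<Longrightarrow> payoff cyc_game 1 (x(1 := y)) \<le> payoff cyc_game 1 x"
    and best2: "\<And>y. y \<in> feasible cyc_game 2 \<Longrightarrow> payoff cyc_game 2 (x(2 := y)) \<le> payoff cyc_game 2 x"
    by (auto simp: pure_nash_equilibrium_def agents_cyc)
  have arcs: "(1,2) \<in> parcs cyc_graph" "(3,4) \<in> parcs cyc_graph"
    "(5,6) \<in> parcs cyc_graph" "(7,8) \<in> parcs cyc_graph"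
    by (auto simp: cyc_graph_def)
  note bin1 = arcs[THEN feasible_cycD(1)[OF feas(1)]]
  note bin2 = arcs[THEN feasible_cycD(1)[OF feas(2)]]
  have zero: "x 1 (5,6) = 0" "x 1 (7,8) = 0" "x 2 (1,2) = 0" "x 2 (3,4) = 0"
  proof -
    show "x 1 (5,6) = 0"
      using feasible_cycD(2)[OF feas(1), of "{(5,6)}"] bin1(3) arcs by (auto simp: cyc_game_sel)
    show "x 1 (7,8) = 0"
      using feasible_cycD(2)[OF feas(1), of "{(7,8)}"] bin1(4) arcs by (auto simp: cyc_game_sel)
    show "x 2 (1,2) = 0"
      using feasible_cycD(2)[OF feas(2), of "{(1,2)}"] bin2(1) arcs by (auto simp: cyc_game_sel)
    show "x 2 (3,4) = 0"
      using feasible_cycD(2)[OF feas(2), of "{(3,4)}"] bin2(2) arcs by (auto simp: cyc_game_sel)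
  qed
  have one: "x 1 (1,2) + x 1 (3,4) \<le> 1" "x 2 (5,6) + x 2 (7,8) \<le> 1"
    using feasible_cycD(2)[OF feas(1), of "{(1,2), (3,4)}"]
      feasible_cycD(2)[OF feas(2), of "{(5,6), (7,8)}"] arcs
    by (simp_all add: cyc_game_sel)
  have single1: "single (1,2) \<in> feasible cyc_game 1" "single (3,4) \<in> feasible cyc_game 1"
    and single2: "single (5,6) \<in> feasible cyc_game 2" "single (7,8) \<in> feasible cyc_game 2"
    by (rule single_feasible, simp)+
  have sv: "single e e = 1" if "e \<in> parcs cyc_graph" for e
    using that by (simp add: single_def)
  \<comment> \<open>What a deviation guarantees is a lower bound for the equilibrium payoff
    too.\<close>
  have dev1_d: "2 \<le> payoff cyc_game 1 x" if "x 2 (7,8) = 1"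
    using payoff_cyc_ge(1)[of "x(1 := single (3,4))"] best1[OF single1(2)] single1(2) sv[OF arcs(2)] that
    by simp
  have dev1: "1 \<le> payoff cyc_game 1 x"
    using payoff_cyc_ge(2)[of "x(1 := single (1,2))"] best1[OF single1(1)] single1(1) sv[OF arcs(1)]
    by simp
  have dev2_a: "2 \<le> payoff cyc_game 2 x" if "x 1 (1,2) = 1"
    using payoff_cyc_ge(3)[of "x(2 := single (7,8))"] best2[OF single2(2)] feas(1) sv[OF arcs(4)] that
    by simp
  have dev2_b: "2 \<le> payoff cyc_game 2 x" if "x 1 (3,4) = 1"
    using payoff_cyc_ge(4)[of "x(2 := single (5,6))"] best2[OF single2(1)] feas(1) sv[OF arcs(3)] that
    by simp
  have bounds: "0 \<le> x 1 (1,2)" "0 \<le> x 1 (3,4)" "0 \<le> x 2 (5,6)" "0 \<le> x 2 (7,8)"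
    using bin1(1,2) bin2(3,4) by linarith+
  have le: "payoff cyc_game 1 x \<le> 2 * x 1 (1,2) + 2 * x 2 (7,8)"
    "payoff cyc_game 1 x \<le> 1 + 2 * x 1 (3,4) + 2 * x 2 (5,6)"
    "payoff cyc_game 2 x \<le> 2 * x 1 (1,2) + 2 * x 2 (5,6)"
    "payoff cyc_game 2 x \<le> 2 * x 1 (3,4) + 2 * x 2 (7,8)"
    using payoff_cyc_le[of x] bounds unfolding zero by linarith+
  show False
  proof (cases "x 1 (1,2) = 1")
    case True
    \<comment> \<open>Agent 2 must answer a with d, but then agent 1 would gain by moving to
      b.\<close>
    have d: "x 2 (7,8) = 1"
      using dev2_a[OF True] le(4) one(1) bin2(4) True by linarith
    show False
      using dev1_d[OF d] le(2) one True d by linarith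
  next
    case False
    then have a: "x 1 (1,2) = 0" using bin1(1) by blast
    \<comment> \<open>Agent 1 can secure 1 by playing a, so without a the arc d must be interdicted.
      This forces b, and agent 2 would then gain by moving to c.\<close>
    have d: "x 2 (7,8) = 1"
      using dev1 le(1) bin2(4) a by linarith
    have "x 1 (3,4) = 1"
      using dev1_d[OF d] le(2) one(2) bin1(2) d by linarith
    from dev2_b[OF this] show False
      using le(3) one(2) a d by linarith
  qed
qed

theorem mainTheorem2:
  shows "\<exists>\<Gamma> :: nat dspi. dspi_game \<Gamma> \<and> \<not> common_source_target \<Gamma> \<and>
           \<not> (\<exists>x. pure_nash_equilibrium \<Gamma> x)"
proof (intro exI conjI)
  show "\<not> common_source_target cyc_game"
    unfolding common_source_target_def agents_cyc by (auto simp: cyc_game_sel)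
qed (use dspi_game_cyc no_equilibrium_cyc in auto)

end
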